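(* Let $d \geq 3$ and $1 \leq j \leq d$ be integers, let $e\in\{0,\frac12,1,\frac32,2\}$, and let $q$ be a prime power, which is moreover the square of a prime power if $e\in\{\frac12,\frac32\}$. Then: (i) $|C_j(1)| = \max\{ |C_j(i)| : 1 \leq i \leq d \}$ if $e > 1$ or $(j,e) = (d,1)$. (ii) $|C_j(d)| = \max\{ |C_j(i)| : 1 \leq i \leq d \}$ if $e \leq 1$. (iii) If $j < d$ is odd, then $C_j(d) = \min\{ C_j(i) : 0 \leq i \leq d \}$.
   Context: With Gaussian coefficients $\genfrac{[}{]}{0pt}{}{a}{m} = \prod_{h=0}^{m-1}\frac{q^{a-h}-1}{q^{m-h}-1}$ (and $0$ if $m<0$), for $0\le i,j\le d$, $$C_j(i) = \sum_{h=\max(i-j, 0)}^{\min(d-j,i)} (-1)^{i-h} \, q^{\binom{i-h}{2} + \binom{j-i+h}{2} + (j-i+h) e} \genfrac{[}{]}{0pt}{}{d-i}{d-j-h} \genfrac{[}{]}{0pt}{}{i}{h}.$$ The numbers $C_j(i)$, $0\le i\le d$, are the eigenvalues of the distance-$j$ graph of the dual polar graph $C_q(d,e)$, whose vertices are the maximal totally isotropic (singular) subspaces of a finite classical polar space of rank $d$ over $\mathbb{F}_q$ with parameter $e$ ($e=1,1,0,2,\frac12,\frac32$ for types $C_d(q)$, $B_d(q)$, $D_d(q)$, ${}^2D_{d+1}(q)$, ${}^2A_{2d}(q)$, ${}^2A_{2d-1}(q)$ respectively), two vertices being adjacent when they meet in codimension 1. *)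

theory Defs
  imports Complex_Main "HOL-Number_Theory.Prime_Powers"
begin

definition gaussian_coeff :: "real \<Rightarrow> int \<Rightarrow> int \<Rightarrow> real" where
  "gaussian_coeff q a m =
     (if m < 0 then 0
      else (\<Prod>h<nat m. (q powi (a - int h) - 1) / (q powi (m - int h) - 1)))"

text \<open>
  The eigenvalue \<open>C\<^sub>j(i)\<close> of the distance-\<open>j\<close> graph of the dual polar graph \<open>C\<^sub>q(d,e)\<close>.
  Meant for \<open>i, j \<le> d\<close>. The lower summation bound \<open>i - j\<close> is truncated subtraction, i.e.
  \<open>max (i - j) 0\<close>; within the summation range \<open>h \<le> i\<close> and \<open>i \<le> j + h\<close>, so the natural number
  differences \<open>i - h\<close> and \<open>j + h - i\<close> are not truncated. The real power is needed because
  \<open>e\<close> may be a half-integer.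
\<close>

definition dual_polar_eigenvalue :: "real \<Rightarrow> nat \<Rightarrow> real \<Rightarrow> nat \<Rightarrow> nat \<Rightarrow> real" where
  "dual_polar_eigenvalue q d e j i =
     (\<Sum>h = i - j..min (d - j) i.
        (-1) ^ (i - h)
        * q powr (real ((i - h) choose 2) + real ((j + h - i) choose 2) + real (j + h - i) * e)
        * gaussian_coeff q (int d - int i) (int d - int j - int h)
        * gaussian_coeff q (int i) (int h))"

end

theory Submission
  imports Defs "HOL-Computational_Algebra.Polynomial"
begin

text \<open>
  By the \<open>q\<close>-binomial theorem \<open>C\<^sub>j(i)\<close> is the coefficient of \<open>x\<^sup>j\<close> in
  \<open>(\<Prod>t<d-i. 1 + q\<^sup>e q\<^sup>t x) (\<Prod>t<i. 1 - q\<^sup>t x)\<close>, that is, an elementary symmetric polynomial.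
  In particular \<open>\<bar>C\<^sub>j(d)\<bar>\<close> is the value at \<open>1, q, \<dots>, q\<^sup>d\<^sup>-\<^sup>1\<close>. If \<open>e \<le> m \<le> i\<close>, the \<open>d\<close> numbers
  belonging to \<open>i\<close> can be arranged so that the \<open>t\<close>-th one has absolute value at most \<open>q\<^sup>t\<close>,
  whence \<open>\<bar>C\<^sub>j(i)\<bar> \<le> \<bar>C\<^sub>j(d)\<bar>\<close>. With \<open>m = 1\<close> this is (ii); with \<open>m = 2\<close> it leaves only the
  comparison of \<open>C\<^sub>j(1)\<close> with \<open>C\<^sub>j(d)\<close>, for which both have closed forms.
\<close>

section \<open>Gaussian coefficients and the q-binomial theorem\<close>

definition qfact :: "real \<Rightarrow> nat \<Rightarrow> real" where
  "qfact q n = (\<Prod>h<n. q ^ Suc h - 1)"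

lemma qfact_Suc: "qfact q (Suc n) = qfact q n * (q ^ Suc n - 1)"
  by (simp add: qfact_def)

lemma qfact_pos:
  assumes "q > 1"
  shows "qfact q n > 0"
  unfolding qfact_def using assms by (intro prod_pos) (simp add: one_less_power del: power_Suc)

lemma prod_powi_diff_eq_qfact:
  assumes "q > 1" "m \<le> n"
  shows "(\<Prod>h<m. q powi (int n - int h) - 1) * qfact q (n - m) = qfact q n"
  using assms(2)
proof (induction m)
  case 0
  then show ?case by simp
next
  case (Suc m)
  then have n: "n - m = Suc (n - Suc m)" by simp
  have "q powi (int n - int m) = q ^ (n - m)"
    using Suc.prems by (simp flip: of_nat_diff)
  then have "(\<Prod>h<Suc m. q powi (int n - int h) - 1) * qfact q (n - Suc m)
      = (\<Prod>h<m. q powi (int n - int h) - 1) * qfact q (n - m)"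
    unfolding n qfact_Suc by simp
  then show ?case using Suc by simp
qed

lemma gaussian_coeff_eq_qfact:
  assumes "q > 1" "m \<le> n"
  shows "gaussian_coeff q (int n) (int m) = qfact q n / (qfact q m * qfact q (n - m))"
proof -
  have "(\<Prod>h<m. q powi (int m - int h) - 1) = qfact q m"
    using prod_powi_diff_eq_qfact[OF assms(1) order_refl, of m] by (simp add: qfact_def)
  moreover have "(\<Prod>h<m. q powi (int n - int h) - 1) = qfact q n / qfact q (n - m)"
    using prod_powi_diff_eq_qfact[OF assms] qfact_pos[OF assms(1), of "n - m"]
    by (simp add: eq_divide_eq)
  ultimately show ?thesis
    by (simp add: gaussian_coeff_def prod_dividef)
qed

lemma gaussian_coeff_eq_0:
  assumes "n < m"
  shows "gaussian_coeff q (int n) (int m) = 0"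
proof -
  have "(\<Prod>h<m. (q powi (int n - int h) - 1) / (q powi (int m - int h) - 1)) = 0"
    \<comment> \<open>The numerator with \<open>h = n\<close> is
      \<open>q powi 0 - 1 = 0\<close>.\<close>
    using assms by (intro prod_zero bexI[of _ n]) auto
  then show ?thesis by (simp add: gaussian_coeff_def)
qed

lemma gaussian_coeff_0: "gaussian_coeff q n 0 = 1"
  by (simp add: gaussian_coeff_def)

lemma gaussian_coeff_nonneg:
  assumes "q > 1"
  shows "gaussian_coeff q (int n) (int m) \<ge> 0"
  using assms gaussian_coeff_eq_qfact[of q m n] gaussian_coeff_eq_0[of n m q] qfact_pos[OF assms]
  by (cases "m \<le> n") (auto simp: less_imp_le)

lemma gaussian_coeff_symmetric:
  assumes "q > 1" "m \<le> n"
  shows "gaussian_coeff q (int n) (int (n - m)) = gaussian_coeff q (int n) (int m)"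
  using assms gaussian_coeff_eq_qfact[of q "n - m" n] gaussian_coeff_eq_qfact[of q m n]
  by (simp add: mult.commute)

text \<open>The ratio of consecutive coefficients, cleared of denominators so that
  \<open>m = n\<close> is covered. It serves Pascal's rule and later the comparison of
  \<open>i = 1\<close> with \<open>i = d\<close>.\<close>

lemma gaussian_coeff_Suc_right:
  assumes "q > 1" "m \<le> n"
  shows "gaussian_coeff q (int n) (int (Suc m)) * (q ^ Suc m - 1)
    = gaussian_coeff q (int n) (int m) * (q ^ (n - m) - 1)"
proof (cases "m = n")
  case True
  then show ?thesis using gaussian_coeff_eq_0[of n "Suc n" q] by simp
next
  case False
  then have n: "n - m = Suc (n - Suc m)" and le: "Suc m \<le> n" using assms by auto
  have "q ^ Suc k - 1 \<noteq> 0" for k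
    using assms one_less_power[of q "Suc k"] by simp
  then show ?thesis
    unfolding gaussian_coeff_eq_qfact[OF assms(1) le] gaussian_coeff_eq_qfact[OF assms] n
      qfact_Suc
    using qfact_pos[OF assms(1), of m] qfact_pos[OF assms(1), of "n - Suc m"]
    by (simp add: field_simps del: power_Suc)
qed

lemma gaussian_coeff_Suc_Suc:
  assumes "q > 1" "m \<le> n"
  shows "gaussian_coeff q (int (Suc n)) (int (Suc m)) * (q ^ Suc m - 1)
    = gaussian_coeff q (int n) (int m) * (q ^ Suc n - 1)"
proof -
  have "q ^ Suc k - 1 \<noteq> 0" for k
    using assms one_less_power[of q "Suc k"] by simp
  then show ?thesis
    using assms qfact_pos[OF assms(1), of m] qfact_pos[OF assms(1), of "n - m"]
    by (simp add: gaussian_coeff_eq_qfact qfact_Suc field_simps del: power_Suc of_nat_Suc)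
qed

text \<open>After multiplication by \<open>q ^ Suc m - 1\<close> this is the identity \<open>q ^ Suc
  n - 1 = (q ^ (n - m) - 1) + q ^ (n - m) * (q ^ Suc m - 1)\<close>.\<close>

lemma gaussian_coeff_pascal:
  assumes "q > 1" "m \<le> n"
  shows "gaussian_coeff q (int (Suc n)) (int (Suc m))
    = gaussian_coeff q (int n) (int (Suc m)) + q ^ (n - m) * gaussian_coeff q (int n) (int m)"
proof -
  have "q ^ Suc n = q ^ (n - m) * q ^ Suc m"
    using assms(2) by (simp flip: power_add)
  then have "gaussian_coeff q (int (Suc n)) (int (Suc m)) * (q ^ Suc m - 1)
    = (gaussian_coeff q (int n) (int (Suc m)) + q ^ (n - m) * gaussian_coeff q (int n) (int m))
      * (q ^ Suc m - 1)"
    unfolding gaussian_coeff_Suc_Suc[OF assms] distrib_right gaussian_coeff_Suc_right[OF assms]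
    by (simp add: algebra_simps del: power_Suc)
  moreover have "q ^ Suc m - 1 \<noteq> 0"
    using assms one_less_power[of q "Suc m"] by simp
  ultimately show ?thesis by simp
qed

lemma Suc_choose_2: "Suc k choose 2 = (k choose 2) + k"
  by (simp add: numeral_2_eq_2)

theorem q_binomial:
  fixes q c :: real
  assumes "q > 1"
  shows "coeff (\<Prod>t<n. [:1, c * q ^ t:]) k
    = c ^ k * q ^ (k choose 2) * gaussian_coeff q (int n) (int k)"
proof (induction n arbitrary: k)
  case 0
  then show ?case
    using gaussian_coeff_eq_0[of 0 k q]
    by (cases k) (auto simp: gaussian_coeff_0 numeral_2_eq_2)
next
  case (Suc n)
  show ?case
  proof (cases k)
    case 0
    then show ?thesis using Suc[of 0] by (simp add: gaussian_coeff_0)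
  next
    case k: (Suc m)
    have split: "coeff (\<Prod>t<Suc n. [:1, c * q ^ t:]) (Suc m)
      = c ^ Suc m * q ^ (Suc m choose 2) * gaussian_coeff q (int n) (int (Suc m))
      + c * q ^ n * (c ^ m * q ^ (m choose 2) * gaussian_coeff q (int n) (int m))"
      using Suc[of "Suc m"] Suc[of m] by (simp add: coeff_pCons)
    show ?thesis
    proof (cases "m \<le> n")
      case True
      \<comment> \<open>The factor \<open>q ^ m\<close> raises \<open>m choose 2\<close> to
        \<open>Suc m choose 2\<close>; \<open>q ^ (n - m)\<close> is the weight in Pascal's
        rule.\<close>
      then have "q ^ n = q ^ m * q ^ (n - m)" by (simp flip: power_add)
      then show ?thesis
        unfolding k split gaussian_coeff_pascal[OF assms True]
        by (simp add: Suc_choose_2 power_add algebra_simps)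
    next
      case False
      then show ?thesis unfolding k split by (simp add: gaussian_coeff_eq_0 del: of_nat_Suc)
    qed
  qed
qed

text \<open>The coefficients are elementary symmetric polynomials, whose monomials all have
  coefficient 1, so the triangle inequality applies term by term.\<close>

lemma abs_coeff_prod_linear_le:
  fixes f g :: "'a \<Rightarrow> real"
  assumes "finite A" "\<And>t. t \<in> A \<Longrightarrow> \<bar>f t\<bar> \<le> g t"
  shows "\<bar>coeff (\<Prod>t\<in>A. [:1, f t:]) j\<bar> \<le> coeff (\<Prod>t\<in>A. [:1, g t:]) j"
  using assms
proof (induction A arbitrary: j rule: finite_induct)
  case empty
  then show ?case by simp
next
  case (insert x A)
  then have IH: "\<bar>coeff (\<Prod>t\<in>A. [:1, f t:]) k\<bar> \<le> coeff (\<Prod>t\<in>A. [:1, g t:]) k" for k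
    by blast
  show ?case
  proof (cases j)
    case 0
    then show ?thesis using insert.hyps IH[of 0] by simp
  next
    case (Suc k)
    have "\<bar>f x * coeff (\<Prod>t\<in>A. [:1, f t:]) k\<bar> \<le> g x * coeff (\<Prod>t\<in>A. [:1, g t:]) k"
      unfolding abs_mult using insert.prems[of x] IH[of k] by (intro mult_mono) auto
    then show ?thesis
      using insert.hyps IH[of "Suc k"] Suc by simp
  qed
qed

section \<open>Eigenvalues as coefficients of a polynomial\<close>

definition eigenvalue_poly :: "real \<Rightarrow> nat \<Rightarrow> real \<Rightarrow> nat \<Rightarrow> real poly" where
  "eigenvalue_poly q d c i = (\<Prod>t<d - i. [:1, c * q ^ t:]) * (\<Prod>t<i. [:1, - (q ^ t):])"

theorem dual_polar_eigenvalue_eq_coeff: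
  assumes "q > 1" "i \<le> d" "j \<le> d"
  shows "dual_polar_eigenvalue q d e j i = coeff (eigenvalue_poly q d (q powr e) i) j"
proof -
  let ?g = "\<lambda>n m. gaussian_coeff q (int n) (int m)"
  define T where "T k = ((q powr e) ^ k * q ^ (k choose 2) * ?g (d - i) k)
    * ((- 1) ^ (j - k) * q ^ ((j - k) choose 2) * ?g i (j - k))" for k
  have neg: "coeff (\<Prod>t<i. [:1, - (q ^ t):]) k = (- 1) ^ k * q ^ (k choose 2) * ?g i k" for k
    using q_binomial[OF assms(1), where c = "-1" and n = i and k = k] by simp
  have "coeff (eigenvalue_poly q d (q powr e) i) j = (\<Sum>k\<le>j. T k)"
    unfolding eigenvalue_poly_def coeff_mult T_def neg q_binomial[OF assms(1)] ..
  \<comment> \<open>The convolution index is \<open>k = j + h - i\<close>. Outside the range of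
    \<open>h\<close> one of the two Gaussian coefficients in \<open>T k\<close> vanishes.\<close>
  also have "\<dots> = (\<Sum>k\<in>(\<lambda>h. j + h - i) ` {i - j..min (d - j) i}. T k)"
  proof (rule sum.mono_neutral_right)
    show "\<forall>k\<in>{..j} - (\<lambda>h. j + h - i) ` {i - j..min (d - j) i}. T k = 0"
    proof
      fix k assume k: "k \<in> {..j} - (\<lambda>h. j + h - i) ` {i - j..min (d - j) i}"
      show "T k = 0"
      proof (rule ccontr)
        assume "T k \<noteq> 0"
        then have "k \<le> d - i" "j - k \<le> i"
          using gaussian_coeff_eq_0[of "d - i" k q] gaussian_coeff_eq_0[of i "j - k" q]
          unfolding T_def by (metis mult_zero_left mult_zero_right not_le)+
        then have "k = j + (k + i - j) - i" "k + i - j \<in> {i - j..min (d - j) i}"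
          using k assms by auto
        then show False using k by blast
      qed
    qed
  qed auto
  also have "\<dots> = (\<Sum>h = i - j..min (d - j) i. T (j + h - i))"
    by (subst sum.reindex) (auto simp: inj_on_def)
  also have "\<dots> = dual_polar_eigenvalue q d e j i"
    unfolding dual_polar_eigenvalue_def
  proof (rule sum.cong)
    fix h assume h: "h \<in> {i - j..min (d - j) i}"
    then have jk: "j - (j + h - i) = i - h" by auto
    have "int (d - i) = int d - int i" "int d - int j - int h = int ((d - i) - (j + h - i))"
      using h assms by auto
    \<comment> \<open>The definition of the eigenvalue has the complementary lower indices
      \<open>(d - i) - k\<close> and \<open>i - (j - k)\<close>, whence the symmetry in
      \<open>g1\<close> and \<open>g2\<close>.\<close>
    then have g1: "gaussian_coeff q (int d - int i) (int d - int j - int h)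
        = ?g (d - i) (j + h - i)"
      using gaussian_coeff_symmetric[OF assms(1), of "j + h - i" "d - i"] h assms by auto
    have g2: "?g i (i - h) = ?g i h"
      using gaussian_coeff_symmetric[OF assms(1), of h i] h by auto
    have "q powr (real ((i - h) choose 2) + real ((j + h - i) choose 2) + real (j + h - i) * e)
        = q ^ ((i - h) choose 2) * q ^ ((j + h - i) choose 2) * (q powr e) ^ (j + h - i)"
      using assms(1) by (simp add: powr_add powr_realpow powr_power mult.commute)
    then show "T (j + h - i) = (-1) ^ (i - h)
        * q powr (real ((i - h) choose 2) + real ((j + h - i) choose 2) + real (j + h - i) * e)
        * gaussian_coeff q (int d - int i) (int d - int j - int h)
        * gaussian_coeff q (int i) (int h)"
      unfolding T_def jk g1 g2 by simp
  qed simp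
  finally show ?thesis ..
qed

section \<open>Bounds by the absolute value at \<open>i = d\<close>\<close>

lemma coeff_eigenvalue_poly_diag:
  assumes "q > 1"
  shows "coeff (eigenvalue_poly q d c d) j = (- 1) ^ j * coeff (\<Prod>t<d. [:1, q ^ t:]) j"
  using q_binomial[OF assms, where c = "-1" and n = d and k = j]
    q_binomial[OF assms, where c = 1 and n = d and k = j]
  by (simp add: eigenvalue_poly_def)

lemma abs_coeff_eigenvalue_poly_le:
  assumes "q > 1" "0 \<le> c" "c \<le> q ^ m" "m \<le> i" "i \<le> d"
  shows "\<bar>coeff (eigenvalue_poly q d c i) j\<bar> \<le> coeff (\<Prod>t<d. [:1, q ^ t:]) j"
proof -
  define n where "n = d - i"
  define r where "r = i - m"
  have d: "d = m + n + r" and i: "i = m + r" using assms by (auto simp: n_def r_def)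
  (* Inserting the n roots c q^t at position m moves each of them m places up, which pays for c,
     and moves the roots -q^t with t >= m to the later positions t + n. *)
  define f where "f t = (if t < m then - (q ^ t) else if t < m + n then c * q ^ (t - m)
    else - (q ^ (t - n)))" for t
  have split: "(\<Prod>t<a + b. h t) = (\<Prod>t<a. h t) * (\<Prod>t<b. h (a + t))"
    for a b :: nat and h :: "nat \<Rightarrow> real poly"
    by (induction b) (simp_all add: mult.assoc)
  have "(\<Prod>t<d. [:1, f t:]) = (\<Prod>t<m. [:1, - (q ^ t):]) * (\<Prod>t<n. [:1, c * q ^ t:])
      * (\<Prod>t<r. [:1, - (q ^ (m + t)):])"
    unfolding d split f_def by (simp add: ac_simps)
  also have "\<dots> = eigenvalue_poly q d c i"
    unfolding eigenvalue_poly_def n_def[symmetric] by (simp add: i split)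
  finally have "eigenvalue_poly q d c i = (\<Prod>t<d. [:1, f t:])" ..
  moreover have "\<bar>f t\<bar> \<le> q ^ t" for t
  proof (cases "m \<le> t \<and> t < m + n")
    case True
    then have "c * q ^ (t - m) \<le> q ^ m * q ^ (t - m)"
      using assms by (intro mult_right_mono) auto
    also have "\<dots> = q ^ t" using True by (simp flip: power_add)
    finally show ?thesis using True assms by (simp add: f_def)
  next
    case False
    then show ?thesis using assms(1) by (auto simp: f_def intro: power_increasing)
  qed
  ultimately show ?thesis by (simp add: abs_coeff_prod_linear_le)
qed

lemma coeff_eigenvalue_poly_0_nonneg:
  assumes "q > 1" "c \<ge> 0"
  shows "coeff (eigenvalue_poly q d c 0) j \<ge> 0"
proof -
  \<comment> \<open>Majorizing the product by itself bounds the absolute value of the coefficient by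
    the coefficient, which is therefore nonnegative.\<close>
  have "\<bar>coeff (\<Prod>t<d. [:1, c * q ^ t:]) j\<bar> \<le> coeff (\<Prod>t<d. [:1, c * q ^ t:]) j"
    using assms by (intro abs_coeff_prod_linear_le) auto
  then show ?thesis by (simp add: eigenvalue_poly_def)
qed

section \<open>Closed forms and the comparison of \<open>i = 1\<close> with
  \<open>i = d\<close>\<close>

lemma coeff_eigenvalue_poly_1:
  assumes "q > 1" "d \<ge> 1"
  defines "G \<equiv> \<lambda>k. q ^ (k choose 2) * gaussian_coeff q (int (d - 1)) (int k)"
  shows "coeff (eigenvalue_poly q d c 1) (Suc k) = c ^ Suc k * G (Suc k) - c ^ k * G k"
  using q_binomial[OF assms(1), where c = c and n = "d - 1"]
  by (simp add: eigenvalue_poly_def G_def mult.commute[of _ "[:1, -1:]"])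

text \<open>Splitting off the factor with \<open>t = 0\<close> leaves the product for
  \<open>c = q\<close>, so the same \<open>G\<close> appears as for \<open>i = 1\<close>.\<close>

lemma coeff_prod_linear_powers:
  assumes "q > 1" "d \<ge> 1"
  defines "G \<equiv> \<lambda>k. q ^ (k choose 2) * gaussian_coeff q (int (d - 1)) (int k)"
  shows "coeff (\<Prod>t<d. [:1, q ^ t:]) (Suc k) = q ^ Suc k * G (Suc k) + q ^ k * G k"
proof -
  obtain n where d: "d = Suc n" using assms(2) by (cases d) auto
  have "(\<Prod>t<d. [:1, q ^ t:]) = [:1, 1:] * (\<Prod>t<n. [:1, q * q ^ t:])"
    unfolding d prod.lessThan_Suc_shift by simp
  then show ?thesis
    using q_binomial[OF assms(1), where c = q and n = n] by (simp add: G_def d)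
qed

text \<open>With \<open>c = s * q\<close> and \<open>j = Suc k\<close> the closed forms reduce the
  claim to \<open>(s ^ k + 1) * (q ^ k * G k) \<le> (s ^ j - 1) * (q ^ j * G j)\<close>, and the
  ratio of \<open>G j\<close> to \<open>G k\<close> is bounded below. The two alternatives for
  \<open>c\<close> are the cases \<open>e = 2\<close> and \<open>e = 3/2\<close>.\<close>

lemma coeff_eigenvalue_poly_1_ge:
  assumes "q > 1" "j \<ge> 1" "j < d" and "q \<ge> 2 \<and> c = q ^ 2 \<or> (\<exists>s\<ge>2. q = s ^ 2 \<and> c = s ^ 3)"
  shows "coeff (\<Prod>t<d. [:1, q ^ t:]) j \<le> coeff (eigenvalue_poly q d c 1) j"
proof -
  obtain k where j: "j = Suc k" using assms(2) by (cases j) auto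
  define G where "G k = q ^ (k choose 2) * gaussian_coeff q (int (d - 1)) (int k)" for k
  have G: "G k \<ge> 0" for k
    unfolding G_def using assms(1) gaussian_coeff_nonneg by simp
  have pos: "q ^ j - 1 > 0" using assms one_less_power[of q j] by simp
  \<comment> \<open>Here \<open>j < d\<close> enters: it makes the exponent \<open>d - 1 - k\<close>
    at least 1.\<close>
  have "q ^ 1 \<le> q ^ (d - 1 - k)" using assms j by (intro power_increasing) auto
  then have "q ^ k * (q - 1) * G k \<le> q ^ k * (q ^ (d - 1 - k) - 1) * G k"
    using assms(1) G by (intro mult_right_mono mult_left_mono) auto
  also have "\<dots> = (q ^ j - 1) * G j"
    using gaussian_coeff_Suc_right[OF assms(1), of k "d - 1"] assms(3)
    by (simp add: G_def j Suc_choose_2 power_add mult.commute mult.left_commute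
        del: power_Suc of_nat_Suc)
  finally have ratio: "q ^ k * (q - 1) * G k \<le> (q ^ j - 1) * G j" .
  \<comment> \<open>The number \<open>s\<close> is \<open>c / q\<close>, that is, \<open>q\<close>
    or the square root of \<open>q\<close>. The last inequality is what remains once
    \<open>ratio\<close> has eliminated \<open>G\<close> and \<open>d\<close>.\<close>
  obtain s where s: "s \<ge> 2" "c = s * q" "(s ^ k + 1) * (q ^ j - 1) \<le> (s ^ j - 1) * (q ^ j * (q - 1))"
    using assms(4)
  proof (elim disjE conjE exE)
    assume q: "q \<ge> 2" "c = q ^ 2"
    have "1 \<le> q ^ k" using q by simp
    moreover have "2 * q ^ k \<le> q ^ j" unfolding j power_Suc using q by (intro mult_right_mono) auto
    moreover have "q ^ j * 1 \<le> q ^ j * (q - 1)" using q by (intro mult_left_mono) auto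
    ultimately have "q ^ k + 1 \<le> q ^ j * (q - 1)" by linarith
    then have "(q ^ j - 1) * (q ^ k + 1) \<le> (q ^ j - 1) * (q ^ j * (q - 1))"
      using pos by (intro mult_left_mono) auto
    then show thesis using q that[of q] by (simp add: power2_eq_square mult.commute)
  next
    fix s :: real
    assume s: "2 \<le> s" "q = s ^ 2" "c = s ^ 3"
    \<comment> \<open>As \<open>q\<close> is at least 4, the factor \<open>q - 1\<close> supplies
      the 3 in \<open>s ^ k + 1 \<le> (s ^ j - 1) * 3\<close>.\<close>
    have "2 ^ 2 \<le> s ^ 2" using s(1) by (intro power_mono) auto
    then have q: "3 \<le> q - 1" using s by simp
    have sk: "1 \<le> s ^ k" using s by simp
    have sj: "2 * s ^ k \<le> s ^ j" unfolding j power_Suc using s by (intro mult_right_mono) auto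
    have "s ^ k + 1 \<le> (s ^ j - 1) * 3" using sk sj by (simp add: left_diff_distrib)
    also have "\<dots> \<le> (s ^ j - 1) * (q - 1)" using q sk sj by (intro mult_left_mono) auto
    finally have "(s ^ k + 1) * (q ^ j - 1) \<le> ((s ^ j - 1) * (q - 1)) * q ^ j"
      using pos sk sj q by (intro mult_mono) auto
    then have "(s ^ k + 1) * (q ^ j - 1) \<le> (s ^ j - 1) * (q ^ j * (q - 1))"
      by (simp only: ac_simps)
    then show thesis
      using s(1) by (rule that[rotated 2]) (simp add: s power2_eq_square power3_eq_cube)
  qed
  have sj: "s ^ j - 1 \<ge> 0" using s(1) by simp
  have "(q ^ j - 1) * ((s ^ k + 1) * (q ^ k * G k))
      \<le> (s ^ j - 1) * (q ^ j * (q - 1)) * (q ^ k * G k)"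
    using mult_right_mono[OF s(3), of "q ^ k * G k"] G[of k] assms(1)
    by (simp add: mult.commute mult.left_commute)
  also have "\<dots> = (s ^ j - 1) * q ^ j * (q ^ k * (q - 1) * G k)" by simp
  also have "\<dots> \<le> (s ^ j - 1) * q ^ j * ((q ^ j - 1) * G j)"
    using ratio sj assms(1) by (intro mult_left_mono) auto
  also have "\<dots> = (q ^ j - 1) * ((s ^ j - 1) * (q ^ j * G j))" by simp
  finally have "(s ^ k + 1) * (q ^ k * G k) \<le> (s ^ j - 1) * (q ^ j * G j)"
    using pos by simp
  then have "q ^ j * G j + q ^ k * G k \<le> c ^ j * G j - c ^ k * G k"
    by (simp add: s(2) power_mult_distrib algebra_simps)
  then show ?thesis
    using coeff_eigenvalue_poly_1[OF assms(1), of d c k]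
      coeff_prod_linear_powers[OF assms(1), of d k] assms(3)
    by (simp add: G_def j)
qed

text \<open>For \<open>j = d\<close> the coefficient \<open>G d\<close> vanishes, so each closed
  form keeps one term and only \<open>q ^ (d - 1) \<le> c ^ (d - 1)\<close> is left.\<close>

lemma abs_coeff_eigenvalue_poly_1_top_ge:
  assumes "q > 1" "d \<ge> 1" "c \<ge> q"
  shows "coeff (\<Prod>t<d. [:1, q ^ t:]) d \<le> \<bar>coeff (eigenvalue_poly q d c 1) d\<bar>"
proof -
  obtain n where d: "d = Suc n" using assms(2) by (cases d) auto
  have top: "gaussian_coeff q (int n) (int (Suc n)) = 0" by (rule gaussian_coeff_eq_0) simp
  define G where "G = q ^ (n choose 2) * gaussian_coeff q (int n) (int n)"
  have G: "G \<ge> 0" unfolding G_def using assms(1) gaussian_coeff_nonneg by simp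
  have "coeff (\<Prod>t<d. [:1, q ^ t:]) d = q ^ n * G"
    using coeff_prod_linear_powers[OF assms(1,2), of n]
    by (simp add: G_def d top del: of_nat_Suc prod.lessThan_Suc)
  also have "\<dots> \<le> c ^ n * G"
    using assms G by (intro mult_right_mono power_mono) auto
  also have "\<dots> = \<bar>coeff (eigenvalue_poly q d c 1) d\<bar>"
    using coeff_eigenvalue_poly_1[OF assms(1,2), of c n] assms
      gaussian_coeff_nonneg[OF assms(1), of n n]
    by (simp add: G_def d top abs_mult del: of_nat_Suc)
  finally show ?thesis .
qed

section \<open>Extremal eigenvalues\<close>

theorem corollary6p5:
  fixes d j q :: nat and e :: real
  assumes "d \<ge> 3" and "1 \<le> j" and "j \<le> d"
    and "e \<in> {0, 1/2, 1, 3/2, 2}"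
    and "primepow q"
    and "e \<in> {1/2, 3/2} \<Longrightarrow> \<exists>r::nat. primepow r \<and> q = r ^ 2"
  defines "C \<equiv> dual_polar_eigenvalue (real q) d e"
  shows
    "(e > 1 \<or> (j, e) = (d, 1) \<longrightarrow> \<bar>C j 1\<bar> = Max {\<bar>C j i\<bar> | i. 1 \<le> i \<and> i \<le> d}) \<and>
     (e \<le> 1 \<longrightarrow> \<bar>C j d\<bar> = Max {\<bar>C j i\<bar> | i. 1 \<le> i \<and> i \<le> d}) \<and>
     (j < d \<and> odd j \<longrightarrow> C j d = Min {C j i | i. i \<le> d})"
proof -
  define Q where "Q = real q powr e"
  define N where "N = coeff (\<Prod>t<d. [:1, real q ^ t:]) j"
  have q2: "real q \<ge> 2" using primepow_gt_Suc_0[OF assms(5)] by simp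
  then have q: "real q > 1" by simp
  have C: "C j i = coeff (eigenvalue_poly q d Q i) j" if "i \<le> d" for i
    unfolding C_def Q_def using that assms(3) q by (intro dual_polar_eigenvalue_eq_coeff)
  have Cd: "C j d = (- 1) ^ j * N"
    unfolding N_def using C[of d] coeff_eigenvalue_poly_diag[OF q] by simp
  have bound: "\<bar>C j i\<bar> \<le> N" if "e \<le> real m" "m \<le> i" "i \<le> d" for m i
  proof -
    have "Q \<le> real q powr real m" unfolding Q_def using that(1) q by (intro powr_mono) auto
    then have "Q \<le> real q ^ m" using q by (simp add: powr_realpow)
    then show ?thesis
      unfolding C[OF that(3)] N_def using that q
      by (intro abs_coeff_eigenvalue_poly_le) (auto simp: Q_def)
  qed
  have e2: "e \<le> 2" using assms(4) by auto
  have N: "N \<ge> 0" using bound[of 2 2] e2 assms(1) by force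
  then have absCd: "\<bar>C j d\<bar> = N" by (simp add: Cd abs_mult)
  \<comment> \<open>No absolute value on the right: the minimum in (iii) needs the sign of
    \<open>C j 1\<close>, which \<open>bound\<close> does not reach when
    \<open>e > 1\<close>.\<close>
  have C1: "N \<le> C j 1" if "e > 1" "j < d"
  proof -
    have "Q = real q ^ 2 \<or> (\<exists>s\<ge>2. real q = s ^ 2 \<and> Q = s ^ 3)"
    proof (cases "e = 2")
      case True
      then show ?thesis using q by (simp add: Q_def)
    next
      case False
      \<comment> \<open>The witness for \<open>s\<close> is the prime power \<open>r\<close> with
        \<open>q = r ^ 2\<close>.\<close>
      then have e: "e = 3/2" using assms(4) that by auto
      then obtain r :: nat where r: "primepow r" "q = r ^ 2" using assms(6) by auto
      have r2: "real r \<ge> 2" using primepow_gt_Suc_0[OF r(1)] by simp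
      have "Q = (real r powr 2) powr (3/2)"
        unfolding Q_def e using r by simp
      also have "\<dots> = real r powr 3" unfolding powr_powr by simp
      also have "\<dots> = real r ^ 3" by simp
      finally have "Q = real r ^ 3" .
      then show ?thesis using r r2 by (intro disjI2 exI[of _ "real r"]) simp
    qed
    then show ?thesis
      using C[of 1] assms(1,2) q q2 that
        coeff_eigenvalue_poly_1_ge[of q j d Q] by (auto simp: N_def)
  qed
  have C1_top: "N \<le> \<bar>C j 1\<bar>" if "e \<ge> 1" "j = d"
  proof -
    have "real q powr 1 \<le> Q" unfolding Q_def using that q by (intro powr_mono) auto
    then show ?thesis
      using C[of 1] assms(1) q abs_coeff_eigenvalue_poly_1_top_ge[of q d Q] that
      by (simp add: N_def)
  qed
  have fin: "finite {f i | i. P i \<and> i \<le> d}" for f :: "nat \<Rightarrow> real" and P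
    by (rule finite_subset[of _ "f ` {..d}"]) auto
  have "\<bar>C j 1\<bar> = Max {\<bar>C j i\<bar> | i. 1 \<le> i \<and> i \<le> d}" if "e > 1 \<or> (j, e) = (d, 1)"
  proof (rule Max_eqI[symmetric])
    have le: "N \<le> \<bar>C j 1\<bar>" using that C1 C1_top assms(3) by fastforce
    fix y assume "y \<in> {\<bar>C j i\<bar> | i. 1 \<le> i \<and> i \<le> d}"
    then obtain i where i: "y = \<bar>C j i\<bar>" "1 \<le> i" "i \<le> d" by blast
    show "y \<le> \<bar>C j 1\<bar>"
      using i le bound[of 2 i] e2 by (cases "i = 1") auto
  qed (use fin assms(1) in auto)
  moreover have "\<bar>C j d\<bar> = Max {\<bar>C j i\<bar> | i. 1 \<le> i \<and> i \<le> d}" if "e \<le> 1"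
    by (rule Max_eqI[symmetric]) (use fin assms(1) that bound[of 1] absCd in auto)
  moreover have "C j d = Min {C j i | i. i \<le> d}" if "j < d" "odd j"
  proof (rule Min_eqI[symmetric])
    have Cd': "C j d = - N" using that Cd by simp
    fix y assume "y \<in> {C j i | i. i \<le> d}"
    then obtain i where i: "y = C j i" "i \<le> d" by blast
    \<comment> \<open>The first two cases are those outside \<open>bound\<close>; there
      \<open>C j i\<close> is nonnegative, hence at least \<open>- N\<close>.\<close>
    consider "i = 0" | "i = 1" "e > 1" | "i \<ge> 1" "e \<le> 1" | "i \<ge> 2" by linarith
    then show "C j d \<le> y"
    proof cases
      case 1
      have "C j 0 \<ge> 0"
        using C[of 0] coeff_eigenvalue_poly_0_nonneg[OF q, of Q d j] by (simp add: Q_def)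
      then show ?thesis using i 1 Cd' N by simp
    next
      case 2
      then show ?thesis using i Cd' N C1 that by simp
    next
      case 3
      then show ?thesis using i Cd' bound[of 1 i] by simp
    next
      case 4
      then show ?thesis using i Cd' bound[of 2 i] e2 by simp
    qed
  qed (use fin[where P = "\<lambda>_. True"] in auto)
  ultimately show ?thesis by blast
qed

end
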